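(* Let $c_1,c_2\in\mathbb{C}$ with $\operatorname{Re} c_1\geq \frac12+|c_2|$ and $c_2\neq 0$, and let $\varphi(s)=c_1+c_2 2^{-s}$, thus inducing a bounded composition operator $C_\varphi:\mathcal{H}^2\to\mathcal{H}^2$. Then $$\zeta(2\operatorname{Re} c_1)\leq \Vert C_\varphi\Vert^2\leq \zeta(2\operatorname{Re} c_1-r|c_2|),$$ where $r\leq 1$ is the smallest positive root of the quadratic polynomial $$P(r)=|c_2|r^2+(1-2\operatorname{Re} c_1)\,r+|c_2|.$$
   Context: For real $\theta$, $\mathbb{C}_\theta=\{s\in\mathbb{C}:\operatorname{Re} s>\theta\}$. The Hardy-Dirichlet space is $\mathcal{H}^2=\{f(s)=\sum_{n=1}^\infty a_n n^{-s}:\ \Vert f\Vert^2=\sum_{n=1}^\infty|a_n|^2<\infty\}$; it is a Hilbert space of analytic functions on $\mathbb{C}_{1/2}$, with orthonormal basis $(n^{-s})_{n\geq1}$. For an analytic map $\varphi:\mathbb{C}_{1/2}\to\mathbb{C}_{1/2}$, the composition operator $C_\varphi$ is defined by $C_\varphi(f)=f\circ\varphi$ for $f\in\mathcal{H}^2$, and $\Vert C_\varphi\Vert$ denotes its operator norm on $\mathcal{H}^2$. $\zeta$ is the Riemann zeta function. *)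

theory Defs
  imports "HOL-Analysis.Analysis"
begin

definition half_plane :: "real \<Rightarrow> complex set" where
  "half_plane \<theta> = {s. Re s > \<theta>}"

(* Shifted indexing throughout: a n is the coefficient of (n + 1) powr (-s).
   The function f is total, but only its values on half_plane (1/2) matter. *)
definition H2_expansion :: "(nat \<Rightarrow> complex) \<Rightarrow> (complex \<Rightarrow> complex) \<Rightarrow> bool" where
  "H2_expansion a f \<longleftrightarrow>
     summable (\<lambda>n. (cmod (a n))\<^sup>2) \<and>
     (\<forall>s\<in>half_plane (1/2). (\<lambda>n. a n * of_nat (Suc n) powr (- s)) sums f s)"

definition H2 :: "(complex \<Rightarrow> complex) set" where
  "H2 = {f. \<exists>a. H2_expansion a f}"

(* The description operator is meaningful for f in H2, because the coefficients of a
   Dirichlet series are determined by its sum on a half-plane. *)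
definition H2_coeffs :: "(complex \<Rightarrow> complex) \<Rightarrow> nat \<Rightarrow> complex" where
  "H2_coeffs f = (THE a. H2_expansion a f)"

definition H2_norm :: "(complex \<Rightarrow> complex) \<Rightarrow> real" where
  "H2_norm f = sqrt (\<Sum>n. (cmod (H2_coeffs f n))\<^sup>2)"

definition comp_op :: "(complex \<Rightarrow> complex) \<Rightarrow> (complex \<Rightarrow> complex) \<Rightarrow> (complex \<Rightarrow> complex)" where
  "comp_op \<phi> f = f \<circ> \<phi>"

definition induces_bounded_comp_op :: "(complex \<Rightarrow> complex) \<Rightarrow> bool" where
  "induces_bounded_comp_op \<phi> \<longleftrightarrow>
     \<phi> analytic_on half_plane (1/2) \<and>
     \<phi> \<in> half_plane (1/2) \<rightarrow> half_plane (1/2) \<and>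
     comp_op \<phi> \<in> H2 \<rightarrow> H2 \<and>
     (\<exists>C. \<forall>f\<in>H2. H2_norm (comp_op \<phi> f) \<le> C * H2_norm f)"

(* A supremum of reals, hence only meaningful for operators bounded on H2. *)
definition H2_onorm :: "((complex \<Rightarrow> complex) \<Rightarrow> (complex \<Rightarrow> complex)) \<Rightarrow> real" where
  "H2_onorm T = (SUP f\<in>{f \<in> H2. H2_norm f \<le> 1}. H2_norm (T f))"

(* The Riemann zeta function at real arguments x > 1; not the continuation to x < 1. *)
definition zeta :: "real \<Rightarrow> real" where
  "zeta x = (\<Sum>n. real (Suc n) powr (- x))"

definition smallest_pos_root :: "(real \<Rightarrow> real) \<Rightarrow> real \<Rightarrow> bool" where
  "smallest_pos_root P r \<longleftrightarrow> 0 < r \<and> P r = 0 \<and> (\<forall>t. 0 < t \<and> P t = 0 \<longrightarrow> r \<le> t)"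

end

theory Submission imports Defs begin

text \<open>
  Put z = 2 powr (-s) and write \<sigma> = Re c1, m = cmod c2; the index n below is the base n \<ge> 1, not its
  predecessor. Expanding n powr (-(c1 + c2 z)) as a power
  series in z turns f with coefficients a n into the Dirichlet series \<Sum>k. b k (2^k) powr (-s), where
  b k = \<Sum>n. a n A n k and A n k = n powr (-c1) (-c2 ln n)^k / k! (lemma \<open>comp_matrix_apply_sums\<close>).
  Since the norm of a Dirichlet series is the Euclidean norm of its coefficient sequence, the composition
  operator has the norm of the infinite matrix A acting on square-summable sequences.

  The lower bound comes from k = 0: b 0 = f c1, the limit of the transformed series as Re s tends to \<infinity>, and
  point evaluation at c1 is a functional of norm sqrt (\<zeta>(2\<sigma>)), attained at the normalised reproducing kernel.

  The upper bound is the Schur test with weights r^k on the k-side. Summing cmod (A n k) r^k over k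
  gives p n = n powr (-(\<sigma> - r m)), and the other condition of the test is, with x = 2\<sigma> - r m,
  \<Sum>n. n powr (-x) (m ln n)^k / k! \<le> \<zeta>(x) r^k for all k.
  The equation P r = 0 says exactly that m = r (x - 1), so this becomes the inequality
  \<Sum>n. n powr (-x) ((x - 1) ln n)^k / k! \<le> \<zeta>(x), lemma \<open>sum_powr_ln_power_le_zeta\<close>.
  For k \<ge> 1 the summand is a unimodal function of n whose integral over [1, \<infinity>) is 1/(x - 1), so the sum
  is at most 1/(x - 1) plus the maximum of the summand. That maximum is below k^k exp(-k) / k! \<le> 1/2,
  whereas the trapezoidal rule for the convex function u powr (-x) yields \<zeta>(x) \<ge> 1/(x - 1) + 1/2.
\<close>

section \<open>Logarithmic moments of the zeta series\<close>

lemma summable_zeta: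
  fixes x :: real
  assumes "x > 1"
  shows "summable (\<lambda>n. real (Suc n) powr (- x))"
  using summable_real_powr_iff[of "-x"] assms by (subst summable_Suc_iff) simp

lemma zeta_pos: "0 < zeta x" if "x > 1" for x :: real
  unfolding zeta_def using that by (intro suminf_pos summable_zeta) auto

text \<open>
  On [n, n + 1] a unimodal g is at least g n minus the amount by which it decreases there. The total
  decrease is at most the peak value g p, so the sum exceeds the integral by at most g p. The integral
  is expressed through the antiderivative F, whose limit at infinity is only bounded by 0.
\<close>
lemma sum_le_unimodal_integral:
  fixes g F :: "real \<Rightarrow> real"
  assumes deriv: "\<And>u. 1 \<le> u \<Longrightarrow> (F has_real_derivative g u) (at u)"
    and inc: "\<And>u v. 1 \<le> u \<Longrightarrow> u \<le> v \<Longrightarrow> v \<le> p \<Longrightarrow> g u \<le> g v"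
    and dec: "\<And>u v. p \<le> u \<Longrightarrow> u \<le> v \<Longrightarrow> g v \<le> g u"
    and p: "1 \<le> p"
    and F: "\<And>u. 1 \<le> u \<Longrightarrow> F u \<le> 0"
    and g: "\<And>u. 1 \<le> u \<Longrightarrow> 0 \<le> g u"
  shows "(\<Sum>n<N. g (real (Suc n))) \<le> g p - F 1"
proof -
  \<comment> \<open>G u is the largest value of g to the right of u, so the drops of G telescope.\<close>
  define G where "G u = g (max u p)" for u
  have step: "g (real (Suc n)) \<le> F (real (Suc (Suc n))) - F (real (Suc n)) + (G (real (Suc n)) - G (real (Suc (Suc n))))" for n
  proof -
    let ?a = "real (Suc n)" and ?b = "real (Suc (Suc n))"
    have "?a < ?b" by simp
    then obtain u where u: "?a < u" "u < ?b" "F ?b - F ?a = (?b - ?a) * g u"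
      using MVT2[of ?a ?b F g] deriv by force
    have a1: "1 \<le> ?a" by simp
    have "g ?a - G ?a + G ?b \<le> g u"
    proof (cases "u \<le> p")
      case True
      then have "g ?a \<le> g u" using inc[of ?a u] u a1 by simp
      moreover have "G ?b \<le> G ?a"
        unfolding G_def by (rule dec) auto
      ultimately show ?thesis by simp
    next
      case False
      then have "g ?b \<le> g u" "G ?b = g ?b"
        using dec[of u ?b] u by (auto simp: G_def max_def)
      moreover have "g ?a \<le> G ?a"
        using inc[of ?a p] a1 by (auto simp: G_def max_def)
      ultimately show ?thesis by simp
    qed
    then show ?thesis using u(3) by simp
  qed
  have "(\<Sum>n<N. g (real (Suc n))) \<le> (\<Sum>n<N. (F (real (Suc (Suc n))) - F (real (Suc n))) + (G (real (Suc n)) - G (real (Suc (Suc n)))))"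
    by (rule sum_mono) (rule step)
  also have "\<dots> = (F (real (Suc N)) - F 1) + (G 1 - G (real (Suc N)))"
    by (simp only: sum.distrib sum_lessThan_telescope[of "\<lambda>n. F (real (Suc n))"]
        sum_lessThan_telescope'[of "\<lambda>n. G (real (Suc n))"]) simp
  also have "\<dots> \<le> g p - F 1"
    using F[of "real (Suc N)"] g[of "max (real (Suc N)) p"] p by (simp add: G_def le_max_iff_disj)
  finally show ?thesis .
qed

text \<open>
  Up to sign, an elementary antiderivative of the Gamma density exp(-y) y^k / k!.
\<close>
lemma exp_minus_truncated_exp_deriv:
  "((\<lambda>y. exp (- y) * (\<Sum>j\<le>k. y ^ j / fact j)) has_real_derivative
     - (exp (- y) * (y ^ k / fact k))) (at y)"
proof (induction k)
  case 0
  show ?case by (auto intro!: derivative_eq_intros)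
next
  case (Suc k)
  have "((\<lambda>y. exp (- y) * (y ^ Suc k / fact (Suc k))) has_real_derivative
     exp (- y) * (y ^ k / fact k) - exp (- y) * (y ^ Suc k / fact (Suc k))) (at y)"
  proof -
    have "((\<lambda>y. exp (- y) * (y ^ Suc k / fact (Suc k))) has_real_derivative
       exp (- y) * (- 1) * (y ^ Suc k / fact (Suc k)) + real (Suc k) * y ^ k / fact (Suc k) * exp (- y)) (at y)"
      by (rule derivative_eq_intros refl | simp)+
    also have "real (Suc k) * y ^ k / fact (Suc k) = y ^ k / fact k"
      by (simp add: field_simps del: of_nat_Suc)
    finally show ?thesis by (simp add: algebra_simps)
  qed
  from DERIV_add[OF Suc.IH this] show ?case
    by (simp add: algebra_simps)
qed

text \<open>
  The derivative of t exp(-c t) has the sign of 1 - c t. Its powers t^k exp(-k c t) have the same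
  peak, which gives the unimodality of the logarithmic moments.
\<close>
lemma mult_exp_minus_mono:
  fixes c s t :: real
  assumes "0 < c" "s \<le> t" "t \<le> 1 / c"
  shows "s * exp (- (c * s)) \<le> t * exp (- (c * t))"
proof (rule DERIV_nonneg_imp_nondecreasing[OF assms(2)])
  fix u assume "s \<le> u" "u \<le> t"
  then have "c * u \<le> 1" using assms by (simp add: field_simps) (smt (verit) mult_left_mono)
  then have "0 \<le> exp (- (c * u)) * (1 - c * u)" by simp
  moreover have "((\<lambda>u. u * exp (- (c * u))) has_real_derivative exp (- (c * u)) * (1 - c * u)) (at u)"
    by (auto intro!: derivative_eq_intros simp: algebra_simps)
  ultimately show "\<exists>y. ((\<lambda>u. u * exp (- (c * u))) has_real_derivative y) (at u) \<and> 0 \<le> y"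
    by blast
qed

lemma mult_exp_minus_antimono:
  fixes c s t :: real
  assumes "0 < c" "s \<le> t" "1 / c \<le> s"
  shows "t * exp (- (c * t)) \<le> s * exp (- (c * s))"
proof (rule DERIV_nonpos_imp_nonincreasing[OF assms(2)])
  fix u assume "s \<le> u" "u \<le> t"
  then have "1 \<le> c * u" using assms by (simp add: field_simps) (smt (verit) mult_left_mono)
  then have "exp (- (c * u)) * (1 - c * u) \<le> 0" by (simp add: mult_nonneg_nonpos)
  moreover have "((\<lambda>u. u * exp (- (c * u))) has_real_derivative exp (- (c * u)) * (1 - c * u)) (at u)"
    by (auto intro!: derivative_eq_intros simp: algebra_simps)
  ultimately show "\<exists>y. ((\<lambda>u. u * exp (- (c * u))) has_real_derivative y) (at u) \<and> y \<le> 0"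
    by blast
qed

text \<open>
  This is the probability that a Poisson variable of integer mean k takes the value k. Passing from k
  to k + 1 multiplies it by exp(-1) (1 + 1/k)^k \<le> 1, so it is largest at k = 1, where it is exp(-1).
\<close>
lemma poisson_mode_prob_le_half:
  assumes "k \<ge> 1"
  shows "exp (- real k) * real k ^ k / fact k \<le> 1 / 2"
  using assms
proof (induction k rule: dec_induct)
  case base
  have "1 + 1 \<le> exp (1::real)" by (rule exp_ge_add_one_self)
  then show ?case by (simp add: exp_minus field_simps)
next
  case (step k)
  have "exp (- real (Suc k)) * real (Suc k) ^ Suc k / fact (Suc k)
      = exp (- real k) * real k ^ k / fact k * (exp (-1) * (1 + 1 / real k) ^ k)"
  proof -
    have "real (Suc k) ^ k = real k ^ k * (1 + 1 / real k) ^ k"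
      using step by (simp flip: power_mult_distrib add: field_simps)
    moreover have "exp (- real (Suc k)) = exp (- real k) * exp (-1)"
      by (simp flip: exp_add)
    moreover have "real (Suc k) ^ Suc k / fact (Suc k) = real (Suc k) ^ k / fact k"
      by (simp add: field_simps del: of_nat_Suc)
    ultimately show ?thesis by (metis (no_types, lifting) mult.assoc mult.commute times_divide_eq_right)
  qed
  also have "\<dots> \<le> exp (- real k) * real k ^ k / fact k * 1"
  proof (rule mult_left_mono)
    have "(1 + 1 / real k) ^ k \<le> exp 1"
      using exp_ge_one_plus_x_over_n_power_n[of k 1] step by simp
    then show "exp (-1) * (1 + 1 / real k) ^ k \<le> 1"
      by (simp add: exp_minus field_simps)
  qed simp
  finally show ?case using step.IH by linarith
qed

text \<open>
  The trapezoidal rule overestimates the integral of the convex function u powr (-x) over [a, a + 1].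
  The error D h of the rule on [a, a + h] vanishes at h = 0, and by the mean value theorem its
  derivative is nonnegative.
\<close>
lemma trapezoid_powr:
  fixes a x :: real
  assumes a: "a > 0" and x: "x > 1"
  shows "(a powr (1 - x) - (a + 1) powr (1 - x)) / (x - 1) \<le> (a powr (- x) + (a + 1) powr (- x)) / 2"
proof -
  define D where "D h = (a powr (- x) + (a + h) powr (- x)) * h / 2
      - (a powr (1 - x) - (a + h) powr (1 - x)) / (x - 1)" for h
  have "D 0 \<le> D 1"
  proof (rule DERIV_nonneg_imp_nondecreasing[where f = D])
    fix h :: real assume h: "0 \<le> h" "h \<le> 1"
    define d where "d = (a powr (- x) - (a + h) powr (- x)) / 2 - x * h * (a + h) powr (- x - 1) / 2"
    have "(D has_real_derivative
       (a powr (- x) + (a + h) powr (- x)) / 2 + (- x) * (a + h) powr (- x - 1) * h / 2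
       - (- ((1 - x) * (a + h) powr (1 - x - 1))) / (x - 1)) (at h)"
      unfolding D_def using h a x
      by (auto intro!: derivative_eq_intros)
    also have "(- ((1 - x) * (a + h) powr (1 - x - 1))) / (x - 1) = (a + h) powr (- x)"
      using x by (simp add: field_simps)
    finally have "(D has_real_derivative d) (at h)"
      by (simp add: d_def algebra_simps add_divide_distrib diff_divide_distrib)
    moreover have "0 \<le> d"
    proof (cases "h = 0")
      case False
      with h have "a < a + h" by simp
      have "\<exists>z. a < z \<and> z < a + h \<and> (a + h) powr (- x) - a powr (- x) = (a + h - a) * ((- x) * z powr (- x - 1))"
        using \<open>a < a + h\<close> a
        by (intro MVT2[of a "a + h" "\<lambda>u. u powr (- x)"]) (auto intro!: derivative_eq_intros)
      then obtain z where z: "a < z" "z < a + h"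
        "(a + h) powr (- x) - a powr (- x) = (a + h - a) * ((- x) * z powr (- x - 1))" by blast
      have "(a + h) powr (- x - 1) \<le> z powr (- x - 1)"
        using z a x by (intro powr_mono2') auto
      then have le: "x * h * (a + h) powr (- x - 1) \<le> x * h * z powr (- x - 1)"
        using x h by (intro mult_left_mono) auto
      have "(a + h) powr (- x) - a powr (- x) = - (x * h * z powr (- x - 1))"
        unfolding z(3) by simp
      then have "d = (x * h * z powr (- x - 1) - x * h * (a + h) powr (- x - 1)) / 2"
        unfolding d_def by argo
      then show ?thesis using le by simp
    qed (simp add: d_def)
    ultimately show "\<exists>y. (D has_real_derivative y) (at h) \<and> 0 \<le> y" by blast
  qed simp
  then show ?thesis using a by (simp add: D_def)
qed

text \<open>
  Sum of the trapezoidal estimates over all unit intervals: every term is counted with weight one,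
  except the first, which is counted with weight 1/2.
\<close>
lemma zeta_lower_bound:
  fixes x :: real
  assumes x: "x > 1"
  shows "1 / (x - 1) + 1 / 2 \<le> zeta x"
proof -
  define t where "t n = real (Suc n) powr (1 - x) / (x - 1)" for n
  define s where "s n = real (Suc n) powr (- x) / 2" for n
  have lim: "(\<lambda>n. (\<Sum>i<n. real (Suc i) powr (- x)) + (s n - 1 / 2 + t n)) \<longlonglongrightarrow> zeta x + (0 - 1 / 2 + 0)"
  proof (intro tendsto_add tendsto_diff tendsto_const)
    show "(\<lambda>n. \<Sum>i<n. real (Suc i) powr (- x)) \<longlonglongrightarrow> zeta x"
      unfolding zeta_def using summable_zeta[OF x] by (rule summable_LIMSEQ)
    have "(\<lambda>n. real (Suc n) powr (- x)) \<longlonglongrightarrow> 0"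
      using summable_zeta[OF x] by (rule summable_LIMSEQ_zero)
    from tendsto_divide[OF this tendsto_const[of 2]] show "s \<longlonglongrightarrow> 0"
      by (simp add: s_def[abs_def])
    have "(\<lambda>n. real n powr (1 - x)) \<longlonglongrightarrow> 0"
      using x by (intro tendsto_neg_powr filterlim_real_sequentially) auto
    then have "(\<lambda>n. real (Suc n) powr (1 - x)) \<longlonglongrightarrow> 0"
      by (rule LIMSEQ_Suc)
    from tendsto_divide[OF this tendsto_const[of "x - 1"]] show "t \<longlonglongrightarrow> 0"
      using x by (simp add: t_def[abs_def])
  qed
  have "1 / (x - 1) \<le> (\<Sum>i<n. real (Suc i) powr (- x)) + (s n - 1 / 2 + t n)" for n
  proof (induction n)
    case 0
    show ?case by (simp add: s_def t_def)
  next
    case (Suc n)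
    have "t n - t (Suc n) \<le> s n + s (Suc n)"
      using trapezoid_powr[of "real (Suc n)" x] x by (simp add: t_def s_def diff_divide_distrib add_divide_distrib add_ac)
    moreover have "real (Suc n) powr (- x) = 2 * s n" by (simp add: s_def)
    ultimately show ?case using Suc by simp
  qed
  then have "1 / (x - 1) \<le> zeta x + (0 - 1 / 2 + 0)"
    by (intro tendsto_lowerbound[OF lim]) auto
  then show ?thesis by simp
qed

text \<open>
  The Taylor coefficients of \<zeta> at x satisfy the Cauchy-type estimate
  c k \<le> \<zeta>(x) / (x - 1)^k, where c k is the modulus of the k-th one, on the disc around x whose
  boundary passes through the pole at 1.
\<close>
lemma sum_powr_ln_power_le_zeta:
  fixes x :: real
  assumes x: "x > 1"
  shows "(\<Sum>n<N. real (Suc n) powr (- x) * ((x - 1) * ln (real (Suc n))) ^ k / fact k) \<le> zeta x"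
proof (cases "k = 0")
  case True
  have "(\<Sum>n<N. real (Suc n) powr (- x)) \<le> zeta x"
    unfolding zeta_def by (rule sum_le_suminf[OF summable_zeta[OF x]]) auto
  with True show ?thesis by simp
next
  case False
  define e where "e = x - 1"
  have e: "e > 0" using x by (simp add: e_def)
  define c where "c = x / real k"
  have c: "c > 0" using x False by (simp add: c_def)
  \<comment> \<open>With t = ln u the summand is a multiple of (t exp(-c t))^k, which peaks at t = 1/c.\<close>
  define p where "p = exp (1 / c)"
  define g where "g u = u powr (- x) * (e * ln u) ^ k / fact k" for u
  define F where "F u = - (exp (- (e * ln u)) * (\<Sum>j\<le>k. (e * ln u) ^ j / fact j)) / e" for u
  have g_eq: "g u = e ^ k / fact k * (ln u * exp (- (c * ln u))) ^ k" if "1 \<le> u" for u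
  proof -
    have "u powr (- x) = exp (- (c * ln u)) ^ k"
      using that False by (simp add: powr_def c_def flip: exp_of_nat_mult)
    then show ?thesis by (simp add: g_def power_mult_distrib)
  qed
  have p1: "1 \<le> p" "ln p = 1 / c" using c by (auto simp: p_def)
  have "(\<Sum>n<N. g (real (Suc n))) \<le> g p - F 1"
  proof (rule sum_le_unimodal_integral[OF _ _ _ p1(1)])
    fix u :: real assume u: "1 \<le> u"
    have "(F has_real_derivative
        - (- (exp (- (e * ln u)) * ((e * ln u) ^ k / fact k)) * (e * (1 / u))) / e) (at u)"
      unfolding F_def using u e
      by (intro DERIV_cdivide DERIV_minus
          DERIV_chain2[OF exp_minus_truncated_exp_deriv] DERIV_cmult DERIV_ln_divide) auto
    also have "- (- (exp (- (e * ln u)) * ((e * ln u) ^ k / fact k)) * (e * (1 / u))) / e = g u"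
    proof -
      have "exp (- (e * ln u)) * (1 / u) = u powr (- x)"
        using u by (simp add: powr_def e_def exp_diff exp_minus field_simps exp_ln)
      moreover have "- (- (exp (- (e * ln u)) * ((e * ln u) ^ k / fact k)) * (e * (1 / u))) / e
          = (exp (- (e * ln u)) * (1 / u)) * (e * ln u) ^ k / fact k"
        using e by (simp add: field_simps)
      ultimately show ?thesis by (simp add: g_def)
    qed
    finally show "(F has_real_derivative g u) (at u)" .
    show "F u \<le> 0" using e u
      by (auto simp: F_def intro!: divide_nonneg_pos mult_nonneg_nonneg sum_nonneg)
    show "0 \<le> g u" using u e by (simp add: g_def)
  next
    fix u v :: real assume "1 \<le> u" "u \<le> v" "v \<le> p"
    moreover from this have "ln v \<le> 1 / c" using p1 by (metis ln_mono order_less_le_trans zero_less_one order_trans)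
    ultimately show "g u \<le> g v"
      using c e mult_exp_minus_mono[OF c, of "ln u" "ln v"]
      by (auto simp: g_eq intro!: divide_right_mono mult_left_mono power_mono)
  next
    fix u v :: real assume uv: "p \<le> u" "u \<le> v"
    moreover from this have "1 / c \<le> ln u" using p1 by (metis ln_mono order_less_le_trans zero_less_one)
    ultimately show "g v \<le> g u"
      using p1 c e mult_exp_minus_antimono[OF c, of "ln u" "ln v"]
      by (auto simp: g_eq intro!: divide_right_mono mult_left_mono power_mono)
  qed
  also have "F 1 = - (1 / e)"
  proof -
    have "(\<Sum>j\<le>k. (0::real) ^ j / fact j) = 1"
      by (induction k) auto
    then show ?thesis by (simp add: F_def)
  qed
  also have "g p \<le> 1 / 2"
  proof -
    have "g p = e ^ k / fact k * (1 / c * exp (- 1)) ^ k"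
      using p1 c by (simp add: g_eq)
    also have "\<dots> = (e / x) ^ k * (exp (- real k) * real k ^ k / fact k)"
      by (simp add: c_def power_mult_distrib power_divide mult_ac flip: exp_of_nat_mult)
    also have "\<dots> \<le> 1 * (1 / 2)"
      using x e False
      by (intro mult_mono poisson_mode_prob_le_half power_le_one) (auto simp: e_def)
    finally show ?thesis by simp
  qed
  finally show ?thesis
    using zeta_lower_bound[OF x] by (simp add: g_def e_def)
qed

section \<open>Dirichlet series with square-summable coefficients\<close>

lemma norm_nat_powr: "cmod (of_nat (Suc n) powr s) = real (Suc n) powr (Re s)"
  using norm_powr_real_powr[of "of_nat (Suc n)" s] by (simp del: of_nat_Suc)

lemma nat_powr_eq_exp: "of_nat (Suc n) powr s = exp (s * of_real (ln (real (Suc n))))" for s :: complex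
proof -
  have "Ln (of_nat (Suc n)) = of_real (ln (real (Suc n)))"
    using Ln_of_real[of "real (Suc n)"] by (simp del: of_nat_Suc)
  then show ?thesis by (simp add: powr_def del: of_nat_Suc)
qed

text \<open>
  Both factors are square-summable, the second one because 2\<theta> > 1.
\<close>
lemma summable_l2_mult_powr:
  fixes a :: "nat \<Rightarrow> complex"
  assumes a: "summable (\<lambda>n. (cmod (a n))\<^sup>2)" and \<theta>: "\<theta> > 1/2"
  shows "summable (\<lambda>n. cmod (a n) * real (Suc n) powr (- \<theta>))"
proof (rule summable_comparison_test')
  show "summable (\<lambda>n. (cmod (a n))\<^sup>2 + real (Suc n) powr (- (2 * \<theta>)))"
    using \<theta> by (intro summable_add a summable_zeta) simp
next
  fix n
  have "(real (Suc n) powr (- \<theta>))\<^sup>2 = real (Suc n) powr (- (2 * \<theta>))"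
    by (simp add: power2_eq_square flip: powr_add del: of_nat_Suc)
  then have "2 * (cmod (a n) * real (Suc n) powr (- \<theta>)) \<le> (cmod (a n))\<^sup>2 + real (Suc n) powr (- (2 * \<theta>))"
    using sum_squares_bound[of "cmod (a n)" "real (Suc n) powr (- \<theta>)"] by (simp del: of_nat_Suc)
  then show "norm (cmod (a n) * real (Suc n) powr (- \<theta>)) \<le> (cmod (a n))\<^sup>2 + real (Suc n) powr (- (2 * \<theta>))"
    by (simp add: abs_mult del: of_nat_Suc) (smt (verit) mult_nonneg_nonneg norm_ge_zero powr_ge_zero)
qed

lemma H2_expansion_exists:
  assumes "summable (\<lambda>n. (cmod (a n))\<^sup>2)"
  shows "H2_expansion a (\<lambda>s. \<Sum>n. a n * of_nat (Suc n) powr (- s))"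
  unfolding H2_expansion_def
proof (intro conjI ballI assms)
  fix s assume "s \<in> half_plane (1/2)"
  then have "summable (\<lambda>n. norm (a n * of_nat (Suc n) powr (- s)))"
    using summable_l2_mult_powr[OF assms, of "Re s"]
    by (simp add: norm_mult norm_nat_powr half_plane_def del: of_nat_Suc)
  then show "(\<lambda>n. a n * of_nat (Suc n) powr (- s)) sums (\<Sum>n. a n * of_nat (Suc n) powr (- s))"
    by (intro summable_sums) (rule summable_norm_cancel)
qed

text \<open>
  If all coefficients before the n-th vanish, multiplying the series by (n + 1) powr t and letting t
  tend to infinity isolates the n-th one: the remaining terms decay like ((n + 1) / (n + 2))^t.
\<close>
lemma dirichlet_series_unique:
  fixes d :: "nat \<Rightarrow> complex"
  assumes bdd: "\<And>n. cmod (d n) \<le> C"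
    and zero: "\<And>t::real. t \<ge> 2 \<Longrightarrow> (\<lambda>n. d n * of_nat (Suc n) powr (- of_real t)) sums 0"
  shows "d n = 0"
proof (induction n rule: less_induct)
  case (less n)
  define q where "q = real (Suc n) / real (Suc (Suc n))"
  have q: "0 < q" "q < 1" by (auto simp: q_def)
  define S where "S = (\<Sum>m. real (Suc m) powr (- 2))"
  have "cmod (d n) \<le> C * S * real (Suc n) ^ 2 * q ^ j" for j
  proof -
    define w where "w m = d m * of_nat (Suc m) powr (- of_real (2 + real j))" for m
    have w: "w sums 0" unfolding w_def by (rule zero) simp
    have nw: "cmod (w m) = cmod (d m) * real (Suc m) powr (- (2 + real j))" for m
      by (simp add: w_def norm_mult norm_nat_powr del: of_nat_Suc)
    have C0: "0 \<le> C" using bdd[of 0] norm_ge_zero order_trans by blast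
    have le: "cmod (if m = n then 0 else w m) \<le> C * real (Suc (Suc n)) powr (- real j) * real (Suc m) powr (- 2)" for m
    proof (cases "m \<le> n")
      case True
      then have "m = n \<or> w m = 0" using less by (auto simp: w_def)
      then show ?thesis using C0 by auto
    next
      case False
      have "real (Suc m) powr (- (2 + real j)) = real (Suc m) powr (- real j) * real (Suc m) powr (- 2)"
        using powr_add[of "real (Suc m)" "- real j" "- 2"] by (simp add: algebra_simps del: of_nat_Suc)
      also have "\<dots> \<le> real (Suc (Suc n)) powr (- real j) * real (Suc m) powr (- 2)"
        using False by (intro mult_right_mono powr_mono2') auto
      finally have "cmod (d m) * real (Suc m) powr (- (2 + real j)) \<le> C * (real (Suc (Suc n)) powr (- real j) * real (Suc m) powr (- 2))"
        using C0 by (intro mult_mono bdd) auto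
      then show ?thesis using False by (simp add: nw mult_ac del: of_nat_Suc)
    qed
    have S: "(\<lambda>m. C * real (Suc (Suc n)) powr (- real j) * real (Suc m) powr (- 2)) sums (C * real (Suc (Suc n)) powr (- real j) * S)"
      unfolding S_def by (intro sums_mult summable_sums summable_zeta) simp
    have "(\<lambda>m. w m - (if m = n then w m else 0)) sums (0 - w n)"
      by (intro sums_diff w sums_single)
    moreover have "w m - (if m = n then w m else 0) = (if m = n then 0 else w m)" for m
      by simp
    ultimately have rest: "(\<lambda>m. if m = n then 0 else w m) sums (- w n)"
      by simp
    have "cmod (w n) \<le> C * real (Suc (Suc n)) powr (- real j) * S"
      using norm_suminf_le[OF le sums_summable[OF S]] rest S by (simp add: sums_iff del: of_nat_Suc)
    then have "cmod (d n) * real (Suc n) powr (- (2 + real j)) * real (Suc n) powr (2 + real j) \<le> C * real (Suc (Suc n)) powr (- real j) * S * real (Suc n) powr (2 + real j)"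
      unfolding nw by (rule mult_right_mono) simp
    moreover have "cmod (d n) * real (Suc n) powr (- (2 + real j)) * real (Suc n) powr (2 + real j) = cmod (d n)"
      by (simp add: mult.assoc flip: powr_add del: of_nat_Suc)
    moreover have "real (Suc (Suc n)) powr (- real j) * real (Suc n) powr (2 + real j) = real (Suc n) ^ 2 * q ^ j"
      by (simp add: q_def powr_add powr_minus powr_realpow power_mult_distrib power_inverse divide_inverse mult_ac del: of_nat_Suc)
    moreover have "C * real (Suc (Suc n)) powr (- real j) * S * real (Suc n) powr (2 + real j)
        = C * S * (real (Suc (Suc n)) powr (- real j) * real (Suc n) powr (2 + real j))"
      by (simp only: mult_ac)
    ultimately show ?thesis by (simp only: mult.assoc)
  qed
  moreover have "(\<lambda>j. C * S * real (Suc n) ^ 2 * q ^ j) \<longlonglongrightarrow> C * S * real (Suc n) ^ 2 * 0"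
    using q by (intro tendsto_mult tendsto_const LIMSEQ_realpow_zero) auto
  ultimately have "cmod (d n) \<le> C * S * real (Suc n) ^ 2 * 0"
    by (intro tendsto_lowerbound[of _ _ sequentially]) auto
  then show ?case by simp
qed

lemma H2_expansion_unique:
  assumes "H2_expansion a f" "H2_expansion b f"
  shows "a = b"
proof
  fix n
  have bounded: "\<exists>C. \<forall>n. cmod (c n) \<le> C" if "H2_expansion c f" for c
  proof -
    have "(\<lambda>n. (cmod (c n))\<^sup>2) \<longlonglongrightarrow> 0"
      using that unfolding H2_expansion_def by (intro summable_LIMSEQ_zero) auto
    then have "(\<lambda>n. sqrt ((cmod (c n))\<^sup>2)) \<longlonglongrightarrow> sqrt 0" by (rule tendsto_real_sqrt)
    then have "c \<longlonglongrightarrow> 0" by (simp add: tendsto_norm_zero_iff)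
    then show ?thesis
      by (metis BseqE convergent_imp_Bseq convergentI)
  qed
  obtain A B where "\<And>n. cmod (a n) \<le> A" "\<And>n. cmod (b n) \<le> B"
    using bounded assms by meson
  then have "cmod (a n - b n) \<le> A + B" for n
    by (meson add_mono norm_triangle_ineq4 order_trans)
  moreover have "(\<lambda>n. (a n - b n) * of_nat (Suc n) powr (- of_real t)) sums 0" if "t \<ge> 2" for t :: real
  proof -
    have "complex_of_real t \<in> half_plane (1/2)" using that by (simp add: half_plane_def)
    then show ?thesis using assms sums_diff unfolding H2_expansion_def
      by (fastforce simp: left_diff_distrib simp del: of_nat_Suc)
  qed
  ultimately have "a n - b n = 0" by (rule dirichlet_series_unique[of "\<lambda>n. a n - b n"])
  then show "a n = b n" by simp
qed

lemma H2_norm_eq: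
  assumes "H2_expansion a f"
  shows "H2_norm f = sqrt (\<Sum>n. (cmod (a n))\<^sup>2)"
proof -
  have "H2_coeffs f = a"
    unfolding H2_coeffs_def using assms H2_expansion_unique by (intro the_equality) auto
  then show ?thesis by (simp add: H2_norm_def)
qed

text \<open>
  The witness is the reproducing kernel at c1, whose coefficients are the conjugates of n powr (-c1),
  divided by its norm.
\<close>
lemma point_evaluation_extremal:
  assumes c: "Re c1 > 1/2"
  obtains a f where "H2_expansion a f" "H2_norm f = 1"
    "(\<Sum>n. a n * of_nat (Suc n) powr (- c1)) = of_real (sqrt (zeta (2 * Re c1)))"
proof -
  define x where "x = 2 * Re c1"
  define Z where "Z = zeta x"
  have x: "x > 1" using c by (simp add: x_def)
  have Z: "Z > 0" unfolding Z_def by (rule zeta_pos[OF x])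
  define a where "a n = cnj (of_nat (Suc n) powr (- c1)) / of_real (sqrt Z)" for n
  have pw: "(cmod (of_nat (Suc n) powr (- c1)))\<^sup>2 = real (Suc n) powr (- x)" for n
    by (simp add: norm_nat_powr x_def power2_eq_square flip: powr_add del: of_nat_Suc)
  have Zs: "(\<lambda>n. real (Suc n) powr (- x)) sums Z"
    unfolding Z_def zeta_def using summable_zeta[OF x] by (rule summable_sums)
  have "(\<lambda>n. real (Suc n) powr (- x) / Z) sums (Z / Z)" by (intro sums_divide Zs)
  moreover have "(cmod (a n))\<^sup>2 = real (Suc n) powr (- x) / Z" for n
    using Z by (simp add: a_def norm_divide power_divide pw del: of_nat_Suc)
  ultimately have na: "(\<lambda>n. (cmod (a n))\<^sup>2) sums 1" using Z by simp
  define f where "f s = (\<Sum>n. a n * of_nat (Suc n) powr (- s))" for s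
  have f: "H2_expansion a f" unfolding f_def using na by (intro H2_expansion_exists) (rule sums_summable)
  have "(\<lambda>n. complex_of_real (real (Suc n) powr (- x)) / of_real (sqrt Z)) sums (of_real Z / of_real (sqrt Z))"
    by (intro sums_divide sums_of_real Zs)
  moreover have "a n * of_nat (Suc n) powr (- c1) = complex_of_real (real (Suc n) powr (- x)) / of_real (sqrt Z)" for n
    unfolding a_def pw[symmetric] complex_norm_square by (simp add: mult.commute del: of_nat_Suc)
  moreover have "complex_of_real Z / of_real (sqrt Z) = of_real (sqrt Z)"
    using Z by (simp add: real_div_sqrt flip: of_real_divide)
  ultimately have "(\<Sum>n. a n * of_nat (Suc n) powr (- c1)) = of_real (sqrt Z)"
    by (simp add: sums_iff)
  then show thesis using that[OF f] H2_norm_eq[OF f] na by (simp add: sums_iff Z_def x_def)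
qed

section \<open>The Schur test and interchange of summation\<close>

text \<open>
  Split the term a n A n k as sqrt (cmod (A n k) p n) times sqrt (cmod (A n k) / p n) cmod (a n) and
  apply the Cauchy-Schwarz inequality for each k. The first factor is controlled by the column
  condition; the second one is summed over k first and controlled by the row condition.
\<close>
lemma schur_test_finite:
  fixes A :: "nat \<Rightarrow> nat \<Rightarrow> complex" and a :: "nat \<Rightarrow> complex" and p q :: "nat \<Rightarrow> real"
  assumes p: "\<And>n. p n > 0" and q: "\<And>k. q k > 0" and M: "M \<ge> 0"
    and row: "\<And>n. (\<Sum>k<K. cmod (A n k) * q k) \<le> p n"
    and col: "\<And>k. (\<Sum>n\<in>I. cmod (A n k) * p n) \<le> M * q k"
  shows "(\<Sum>k<K. (cmod (\<Sum>n\<in>I. a n * A n k))\<^sup>2) \<le> M * (\<Sum>n\<in>I. (cmod (a n))\<^sup>2)"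
proof -
  have "(cmod (\<Sum>n\<in>I. a n * A n k))\<^sup>2 \<le> M * (\<Sum>n\<in>I. (cmod (a n))\<^sup>2 / p n * (cmod (A n k) * q k))" for k
  proof -
    let ?u = "\<lambda>n. sqrt (cmod (A n k) * p n)"
    let ?v = "\<lambda>n. sqrt (cmod (A n k) / p n) * cmod (a n)"
    have uv: "cmod (a n * A n k) = ?u n * ?v n" for n
      using p[of n] by (simp add: norm_mult real_sqrt_mult real_sqrt_divide field_simps)
    have "(cmod (\<Sum>n\<in>I. a n * A n k))\<^sup>2 \<le> (\<Sum>n\<in>I. ?u n * ?v n)\<^sup>2"
      by (intro power_mono norm_sum[THEN order_trans]) (simp_all only: uv order_refl norm_ge_zero)
    also have "\<dots> \<le> (\<Sum>n\<in>I. (?u n)\<^sup>2) * (\<Sum>n\<in>I. (?v n)\<^sup>2)"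
      by (rule Cauchy_Schwarz_ineq_sum)
    also have "\<dots> = (\<Sum>n\<in>I. cmod (A n k) * p n) * (\<Sum>n\<in>I. (cmod (a n))\<^sup>2 / p n * cmod (A n k))"
      using p by (simp add: power_mult_distrib less_imp_le mult_ac)
    also have "\<dots> \<le> M * q k * (\<Sum>n\<in>I. (cmod (a n))\<^sup>2 / p n * cmod (A n k))"
      using p by (intro mult_right_mono col sum_nonneg) (simp add: less_imp_le)
    finally show ?thesis by (simp add: sum_distrib_left mult_ac)
  qed
  then have "(\<Sum>k<K. (cmod (\<Sum>n\<in>I. a n * A n k))\<^sup>2)
      \<le> (\<Sum>k<K. M * (\<Sum>n\<in>I. (cmod (a n))\<^sup>2 / p n * (cmod (A n k) * q k)))"
    by (rule sum_mono)
  also have "\<dots> = M * (\<Sum>n\<in>I. (cmod (a n))\<^sup>2 / p n * (\<Sum>k<K. cmod (A n k) * q k))"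
    unfolding sum_distrib_left by (rule sum.swap)
  also have "\<dots> \<le> M * (\<Sum>n\<in>I. (cmod (a n))\<^sup>2 / p n * p n)"
    using p by (intro mult_left_mono sum_mono row M) (simp add: less_imp_le)
  also have "\<dots> = M * (\<Sum>n\<in>I. (cmod (a n))\<^sup>2)"
    using p by (simp add: less_le)
  finally show ?thesis .
qed

lemma schur_test:
  fixes A :: "nat \<Rightarrow> nat \<Rightarrow> complex" and a b :: "nat \<Rightarrow> complex" and p q :: "nat \<Rightarrow> real"
  assumes p: "\<And>n. p n > 0" and q: "\<And>k. q k > 0" and M: "M \<ge> 0"
    and row: "\<And>n K. (\<Sum>k<K. cmod (A n k) * q k) \<le> p n"
    and col: "\<And>k N. (\<Sum>n<N. cmod (A n k) * p n) \<le> M * q k"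
    and a: "summable (\<lambda>n. (cmod (a n))\<^sup>2)"
    and b: "\<And>k. (\<lambda>n. a n * A n k) sums b k"
  shows "summable (\<lambda>k. (cmod (b k))\<^sup>2)"
    and "(\<Sum>k. (cmod (b k))\<^sup>2) \<le> M * (\<Sum>n. (cmod (a n))\<^sup>2)"
proof -
  have bound: "(\<Sum>k<K. (cmod (b k))\<^sup>2) \<le> M * (\<Sum>n. (cmod (a n))\<^sup>2)" for K
  proof (rule LIMSEQ_le)
    show "(\<lambda>N. \<Sum>k<K. (cmod (\<Sum>n<N. a n * A n k))\<^sup>2) \<longlonglongrightarrow> (\<Sum>k<K. (cmod (b k))\<^sup>2)"
      using b unfolding sums_def by (intro tendsto_sum tendsto_power tendsto_norm) auto
    show "(\<lambda>N. M * (\<Sum>n<N. (cmod (a n))\<^sup>2)) \<longlonglongrightarrow> M * (\<Sum>n. (cmod (a n))\<^sup>2)"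
      using a by (intro tendsto_mult tendsto_const summable_LIMSEQ)
    show "\<exists>N0. \<forall>N\<ge>N0. (\<Sum>k<K. (cmod (\<Sum>n<N. a n * A n k))\<^sup>2) \<le> M * (\<Sum>n<N. (cmod (a n))\<^sup>2)"
      by (intro exI allI impI schur_test_finite[OF p q M row col])
  qed
  show s: "summable (\<lambda>k. (cmod (b k))\<^sup>2)"
    by (rule bounded_imp_summable[where B = "M * (\<Sum>n. (cmod (a n))\<^sup>2)"])
      (use bound in \<open>simp_all only: flip: lessThan_Suc_atMost, simp_all\<close>)
  show "(\<Sum>k. (cmod (b k))\<^sup>2) \<le> M * (\<Sum>n. (cmod (a n))\<^sup>2)"
    by (rule suminf_le_const[OF s bound])
qed

text \<open>
  Fubini's theorem for a double series that converges absolutely.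
\<close>
lemma sums_swap:
  fixes g :: "nat \<Rightarrow> nat \<Rightarrow> complex"
  assumes row: "\<And>n. (\<lambda>k. cmod (g n k)) sums R n" and R: "summable R"
    and h: "\<And>n. (\<lambda>k. g n k) sums h n" and H: "h sums H"
  shows "summable (\<lambda>n. g n k)" and "(\<lambda>k. \<Sum>n. g n k) sums H"
proof -
  have R0: "0 \<le> R n" for n
    by (rule sums_le[OF _ sums_zero row[of n]]) simp
  have row': "((\<lambda>k. cmod (g n k)) has_sum R n) UNIV" for n
    using row by (intro norm_summable_imp_has_sum) (auto simp: sums_iff)
  have "(\<lambda>(n, k). cmod (g n k)) summable_on (UNIV \<times> UNIV)"
  proof (rule summable_on_SigmaI[where g = R])
    show "R summable_on UNIV"
      using R R0 by (intro norm_summable_imp_summable_on) simp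
  qed (simp_all add: row')
  then have summ: "(\<lambda>(n, k). g n k) summable_on (UNIV \<times> UNIV)"
    by - (rule Infinite_Sum.abs_summable_summable, simp add: case_prod_unfold)
  have hn: "((\<lambda>k. g n k) has_sum h n) UNIV" for n
    using row h by (intro norm_summable_imp_has_sum) (auto simp: sums_iff)
  have hR: "cmod (h n) \<le> R n" for n
    using summable_norm[of "g n"] row[of n] h[of n] by (simp add: sums_iff)
  have HH: "(h has_sum H) UNIV"
    by (intro norm_summable_imp_has_sum[OF _ H] summable_comparison_test'[OF R])
      (use hR in auto)
  have tot: "((\<lambda>(n, k). g n k) has_sum H) (UNIV \<times> UNIV)"
    by (rule has_sum_SigmaI[OF _ HH summ]) (simp add: hn)
  have tot': "((\<lambda>(k, n). g n k) has_sum H) (UNIV \<times> UNIV)"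
    using iffD1[OF has_sum_swap tot] by (simp only: prod.case)
  have col: "(\<lambda>n. g n k) summable_on UNIV" for k
    by (rule summable_on_SigmaD1[OF has_sum_imp_summable[OF tot']]) simp
  show "summable (\<lambda>n. g n k)" using col by (rule summable_on_imp_summable)
  have "((\<lambda>n. g n k) has_sum (\<Sum>n. g n k)) UNIV" for k
    using has_sum_infsum[OF col[of k]] sums_unique[OF has_sum_imp_sums[OF has_sum_infsum[OF col[of k]]]]
    by simp
  then have "((\<lambda>k. \<Sum>n. g n k) has_sum H) UNIV"
    by (intro has_sum_SigmaD[OF tot']) auto
  then show "(\<lambda>k. \<Sum>n. g n k) sums H" by (rule has_sum_imp_sums)
qed

section \<open>The matrix of the composition operator\<close>

text \<open>
  The coefficient of z^k in (n + 1) powr (-(c1 + c2 z)), hence the entry of the matrix that sends the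
  coefficients of f to those of f composed with c1 + c2 2 powr (-s).
\<close>
definition comp_matrix :: "complex \<Rightarrow> complex \<Rightarrow> nat \<Rightarrow> nat \<Rightarrow> complex" where
  "comp_matrix c1 c2 n k = of_nat (Suc n) powr (- c1) * (- c2 * of_real (ln (real (Suc n)))) ^ k / fact k"

lemma norm_comp_matrix:
  "cmod (comp_matrix c1 c2 n k) = real (Suc n) powr (- Re c1) * (cmod c2 * ln (real (Suc n))) ^ k / fact k"
proof -
  have "0 \<le> ln (real (Suc n))" by simp
  then show ?thesis
    by (simp add: comp_matrix_def norm_mult norm_divide norm_power norm_nat_powr del: of_nat_Suc)
qed

lemma comp_matrix_sums:
  "(\<lambda>k. comp_matrix c1 c2 n k * z ^ k) sums (of_nat (Suc n) powr (- (c1 + c2 * z)))"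
proof -
  let ?L = "complex_of_real (ln (real (Suc n)))"
  have "(\<lambda>k. of_nat (Suc n) powr (- c1) * ((- c2 * z * ?L) ^ k /\<^sub>R fact k)) sums
      (of_nat (Suc n) powr (- c1) * exp (- c2 * z * ?L))"
    by (intro sums_mult exp_converges)
  also have "of_nat (Suc n) powr (- c1) * exp (- c2 * z * ?L) = of_nat (Suc n) powr (- (c1 + c2 * z))"
    by (simp add: nat_powr_eq_exp algebra_simps flip: exp_add del: of_nat_Suc)
  also have "- c2 * z * ?L = (- c2 * ?L) * z" by simp
  also have "(\<lambda>k. of_nat (Suc n) powr (- c1) * (((- c2 * ?L) * z) ^ k /\<^sub>R fact k)) = (\<lambda>k. comp_matrix c1 c2 n k * z ^ k)"
    unfolding power_mult_distrib[of "- c2 * ?L" z]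
    by (simp add: comp_matrix_def scaleR_conv_of_real field_simps fun_eq_iff del: of_nat_Suc)
  finally show ?thesis .
qed

text \<open>
  The row sums of the Schur test: the moduli of the coefficients again form an exponential series,
  the one for Re c1 and - cmod c2.
\<close>
lemma norm_comp_matrix_sums:
  "(\<lambda>k. cmod (comp_matrix c1 c2 n k) * x ^ k) sums (real (Suc n) powr (- (Re c1 - cmod c2 * x)))"
proof -
  let ?L = "ln (real (Suc n))"
  have "(\<lambda>k. real (Suc n) powr (- Re c1) * ((cmod c2 * x * ?L) ^ k /\<^sub>R fact k)) sums
      (real (Suc n) powr (- Re c1) * exp (cmod c2 * x * ?L))"
    by (intro sums_mult exp_converges)
  also have "real (Suc n) powr (- Re c1) * exp (cmod c2 * x * ?L) = real (Suc n) powr (- (Re c1 - cmod c2 * x))"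
    by (simp add: powr_def algebra_simps flip: exp_add del: of_nat_Suc)
  also have "(\<lambda>k. real (Suc n) powr (- Re c1) * ((cmod c2 * x * ?L) ^ k /\<^sub>R fact k)) = (\<lambda>k. cmod (comp_matrix c1 c2 n k) * x ^ k)"
    by (simp add: norm_comp_matrix power_mult_distrib field_simps fun_eq_iff del: of_nat_Suc)
  finally show ?thesis .
qed

lemma symbol_in_half_plane:
  assumes "Re c1 \<ge> 1/2 + cmod c2" "c2 \<noteq> 0" "cmod z < 1"
  shows "c1 + c2 * z \<in> half_plane (1/2)"
proof -
  have "\<bar>Re (c2 * z)\<bar> \<le> cmod c2 * cmod z"
    using abs_Re_le_cmod[of "c2 * z"] by (simp add: norm_mult)
  also have "\<dots> < cmod c2" using assms by simp
  finally show ?thesis using assms by (simp add: half_plane_def)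
qed

text \<open>
  Interchanging the sums over n and k is legitimate when cmod z < 1: summing absolute values over k
  first leaves \<Sum>n. cmod (a n) n powr (-\<theta>) with \<theta> = Re c1 - cmod c2 cmod z > 1/2, and this converges for
  square-summable a.
\<close>
lemma comp_matrix_apply_sums:
  fixes a :: "nat \<Rightarrow> complex"
  assumes c: "Re c1 \<ge> 1/2 + cmod c2" "c2 \<noteq> 0"
    and a: "summable (\<lambda>n. (cmod (a n))\<^sup>2)"
  shows "(\<lambda>n. a n * comp_matrix c1 c2 n k) sums (\<Sum>n. a n * comp_matrix c1 c2 n k)"
    and "cmod z < 1 \<Longrightarrow> (\<lambda>n. a n * of_nat (Suc n) powr (- (c1 + c2 * z))) sums F \<Longrightarrow>
      (\<lambda>k. (\<Sum>n. a n * comp_matrix c1 c2 n k) * z ^ k) sums F"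
proof -
  have main: "summable (\<lambda>n. a n * comp_matrix c1 c2 n k * z ^ k)"
      "(\<lambda>k. \<Sum>n. a n * comp_matrix c1 c2 n k * z ^ k) sums F"
    if z: "cmod z < 1" and F: "(\<lambda>n. a n * of_nat (Suc n) powr (- (c1 + c2 * z))) sums F" for z F k
  proof -
    let ?R = "\<lambda>n. cmod (a n) * real (Suc n) powr (- (Re c1 - cmod c2 * cmod z))"
    have 1: "(\<lambda>k. cmod (a n * comp_matrix c1 c2 n k * z ^ k)) sums ?R n" for n
      using sums_mult[OF norm_comp_matrix_sums[of c1 c2 n "cmod z"], of "cmod (a n)"]
      by (simp add: norm_mult norm_power mult.assoc)
    have "cmod c2 * cmod z < cmod c2" using z c(2) by simp
    then have "Re c1 - cmod c2 * cmod z > 1/2" using c(1) by linarith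
    then have 2: "summable ?R" by (rule summable_l2_mult_powr[OF a])
    have 3: "(\<lambda>k. a n * comp_matrix c1 c2 n k * z ^ k) sums (a n * of_nat (Suc n) powr (- (c1 + c2 * z)))" for n
      using sums_mult[OF comp_matrix_sums[of c1 c2 n z], of "a n"] by (simp add: mult.assoc)
    show "summable (\<lambda>n. a n * comp_matrix c1 c2 n k * z ^ k)"
        "(\<lambda>k. \<Sum>n. a n * comp_matrix c1 c2 n k * z ^ k) sums F"
      using sums_swap[OF 1 2 3 F] by blast+
  qed
  have summ: "summable (\<lambda>n. a n * comp_matrix c1 c2 n k)" for k
  proof -
    \<comment> \<open>Any z with 0 < cmod z < 1 shows that the sum defining b k converges.\<close>
    have "c1 + c2 * (1/2) \<in> half_plane (1/2)"
      by (rule symbol_in_half_plane[OF c]) simp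
    then obtain F where "(\<lambda>n. a n * of_nat (Suc n) powr (- (c1 + c2 * (1/2)))) sums F"
      using H2_expansion_exists[OF a] unfolding H2_expansion_def by blast
    from main(1)[OF _ this, of k] have "summable (\<lambda>n. a n * comp_matrix c1 c2 n k * (1/2) ^ k)"
      by simp
    from summable_mult2[OF this, of "2 ^ k"] show ?thesis
      by (simp add: power_divide)
  qed
  then show "(\<lambda>n. a n * comp_matrix c1 c2 n k) sums (\<Sum>n. a n * comp_matrix c1 c2 n k)"
    by (rule summable_sums)
  show "(\<lambda>k. (\<Sum>n. a n * comp_matrix c1 c2 n k) * z ^ k) sums F"
    if "cmod z < 1" "(\<lambda>n. a n * of_nat (Suc n) powr (- (c1 + c2 * z))) sums F"
    using main(2)[OF that] suminf_mult2[OF summ] by simp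
qed

text \<open>
  The coefficient sequence of \<Sum>k. b k (2^k) powr (-s). Index m belongs to the base m + 1, so b k
  sits at the index 2^k - 1.
\<close>
definition on_powers_of_2 :: "(nat \<Rightarrow> complex) \<Rightarrow> nat \<Rightarrow> complex" where
  "on_powers_of_2 b m = (if \<exists>k. Suc m = 2 ^ k then b (THE k. Suc m = 2 ^ k) else 0)"

lemma on_powers_of_2_at_power: "on_powers_of_2 b (2 ^ k - 1) = b k"
  by (auto simp: on_powers_of_2_def)

lemma on_powers_of_2_eq_0: "m \<notin> range (\<lambda>k. 2 ^ k - 1) \<Longrightarrow> on_powers_of_2 b m = 0"
  unfolding on_powers_of_2_def by (metis diff_Suc_1 rangeI)

lemma strict_mono_power_minus_1: "strict_mono (\<lambda>k::nat. 2 ^ k - 1 :: nat)"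
  by (rule strict_monoI) (simp add: diff_less_mono)

lemma H2_expansion_on_powers_of_2:
  assumes b: "summable (\<lambda>k. (cmod (b k))\<^sup>2)"
    and F: "\<And>s. s \<in> half_plane (1/2) \<Longrightarrow> (\<lambda>k. b k * (2 powr (- s)) ^ k) sums F s"
  shows "H2_expansion (on_powers_of_2 b) F"
    and "(\<Sum>m. (cmod (on_powers_of_2 b m))\<^sup>2) = (\<Sum>k. (cmod (b k))\<^sup>2)"
proof -
  show "(\<Sum>m. (cmod (on_powers_of_2 b m))\<^sup>2) = (\<Sum>k. (cmod (b k))\<^sup>2)"
    using suminf_mono_reindex[OF strict_mono_power_minus_1, of "\<lambda>m. (cmod (on_powers_of_2 b m))\<^sup>2"]
    by (simp add: on_powers_of_2_at_power[unfolded One_nat_def] on_powers_of_2_eq_0)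
  show "H2_expansion (on_powers_of_2 b) F"
    unfolding H2_expansion_def
  proof (intro conjI ballI)
    show "summable (\<lambda>m. (cmod (on_powers_of_2 b m))\<^sup>2)"
      using summable_mono_reindex[OF strict_mono_power_minus_1, of "\<lambda>m. (cmod (on_powers_of_2 b m))\<^sup>2"] b
      by (simp add: on_powers_of_2_at_power[unfolded One_nat_def] on_powers_of_2_eq_0)
    fix s assume s: "s \<in> half_plane (1/2)"
    have "of_nat (Suc (2 ^ k - 1)) powr (- s) = (2 powr (- s)) ^ k" for k
    proof -
      have L: "Ln 2 = of_real (ln 2)" using Ln_of_real[of 2] by simp
      have "Suc (2 ^ k - 1) = 2 ^ k" by simp
      then have "of_nat (Suc (2 ^ k - 1)) powr (- s) = exp (- s * of_real (ln (2 ^ k)))"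
        unfolding nat_powr_eq_exp by simp
      also have "\<dots> = (2 powr (- s)) ^ k"
        by (simp add: powr_def L ln_realpow mult_ac flip: exp_of_nat_mult)
      finally show ?thesis .
    qed
    then have "(\<lambda>k. on_powers_of_2 b (2 ^ k - 1) * of_nat (Suc (2 ^ k - 1)) powr (- s)) sums F s"
      using F[OF s] by (simp only: on_powers_of_2_at_power)
    then show "(\<lambda>m. on_powers_of_2 b m * of_nat (Suc m) powr (- s)) sums F s"
      using sums_mono_reindex[OF strict_mono_power_minus_1, of "\<lambda>m. on_powers_of_2 b m * of_nat (Suc m) powr (- s)"]
      by (simp add: on_powers_of_2_eq_0 del: of_nat_Suc)
  qed
qed

lemma cmod_2_powr_less_1: "s \<in> half_plane (1/2) \<Longrightarrow> cmod (2 powr (- s)) < 1"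
  using norm_nat_powr[of 1 "- s"] by (simp add: half_plane_def powr_less_one)

text \<open>
  The Schur test applied to the matrix of the operator. The coefficient b 0, which is the value of f
  at c1, is singled out for the lower estimate of the norm.
\<close>
lemma comp_op_H2_bound:
  fixes c1 c2 :: complex
  assumes c: "Re c1 \<ge> 1/2 + cmod c2" "c2 \<noteq> 0"
    and r: "0 < r" "cmod c2 * r\<^sup>2 + (1 - 2 * Re c1) * r + cmod c2 = 0"
    and f: "H2_expansion a f"
  defines "g \<equiv> comp_op (\<lambda>s. c1 + c2 * 2 powr (- s)) f"
    and "b \<equiv> (\<lambda>k. \<Sum>n. a n * comp_matrix c1 c2 n k)"
  shows "g \<in> H2"
    and "(H2_norm g)\<^sup>2 \<le> zeta (2 * Re c1 - r * cmod c2) * (H2_norm f)\<^sup>2"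
    and "cmod (b 0) \<le> H2_norm g"
proof -
  define x where "x = 2 * Re c1 - r * cmod c2"
  have a: "summable (\<lambda>n. (cmod (a n))\<^sup>2)" using f by (simp add: H2_expansion_def)
  \<comment> \<open>The quadratic equation matches the k-th power of the radius x - 1 with the weight r^k.\<close>
  have xr: "r * (x - 1) = cmod c2" using r(2) by (simp add: x_def algebra_simps power2_eq_square)
  then have x: "x > 1" using r(1) c(2)
    by (metis diff_gt_0_iff_gt zero_less_mult_pos zero_less_norm_iff)
  define p where "p n = real (Suc n) powr (- (Re c1 - cmod c2 * r))" for n
  have row: "(\<Sum>k<K. cmod (comp_matrix c1 c2 n k) * r ^ k) \<le> p n" for n K
    using norm_comp_matrix_sums[of c1 c2 n r] r(1) unfolding p_def sums_iff
    by (metis (no_types, lifting) sum_le_suminf finite_lessThan less_imp_le mult_nonneg_nonneg norm_ge_zero zero_le_power)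
  have col: "(\<Sum>n<N. cmod (comp_matrix c1 c2 n k) * p n) \<le> zeta x * r ^ k" for k N
  proof -
    have "cmod (comp_matrix c1 c2 n k) * p n
        = r ^ k * (real (Suc n) powr (- x) * ((x - 1) * ln (real (Suc n))) ^ k / fact k)" for n
    proof -
      have "real (Suc n) powr (- Re c1) * p n = real (Suc n) powr (- x)"
        by (simp add: p_def x_def algebra_simps flip: powr_add del: of_nat_Suc)
      moreover have "(cmod c2 * ln (real (Suc n))) ^ k = r ^ k * ((x - 1) * ln (real (Suc n))) ^ k"
        by (simp add: xr flip: power_mult_distrib mult.assoc del: of_nat_Suc)
      moreover have "cmod (comp_matrix c1 c2 n k) * p n = (real (Suc n) powr (- Re c1) * p n) * (cmod c2 * ln (real (Suc n))) ^ k / fact k"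
        by (simp add: norm_comp_matrix del: of_nat_Suc)
      ultimately show ?thesis by (simp del: of_nat_Suc)
    qed
    then have "(\<Sum>n<N. cmod (comp_matrix c1 c2 n k) * p n) = r ^ k * (\<Sum>n<N. real (Suc n) powr (- x) * ((x - 1) * ln (real (Suc n))) ^ k / fact k)"
      by (simp only: sum_distrib_left)
    also have "\<dots> \<le> r ^ k * zeta x"
      using r(1) by (intro mult_left_mono sum_powr_ln_power_le_zeta x) simp
    finally show ?thesis by (simp add: mult.commute)
  qed
  have z0: "0 \<le> zeta x" using zeta_pos[OF x] by simp
  have b: "(\<lambda>n. a n * comp_matrix c1 c2 n k) sums b k" for k
    unfolding b_def by (rule comp_matrix_apply_sums(1)[OF c a])
  have schur: "summable (\<lambda>k. (cmod (b k))\<^sup>2)" "(\<Sum>k. (cmod (b k))\<^sup>2) \<le> zeta x * (\<Sum>n. (cmod (a n))\<^sup>2)"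
    by (rule schur_test[OF _ _ z0 row col a b]; use r(1) in \<open>simp add: p_def\<close>)+
  have "(\<lambda>k. b k * (2 powr (- s)) ^ k) sums g s" if s: "s \<in> half_plane (1/2)" for s
  proof -
    have z: "cmod (2 powr (- s)) < 1" by (rule cmod_2_powr_less_1[OF s])
    have "(\<lambda>n. a n * of_nat (Suc n) powr (- (c1 + c2 * 2 powr (- s)))) sums g s"
      using f symbol_in_half_plane[OF c z] unfolding H2_expansion_def g_def comp_op_def o_def by blast
    from comp_matrix_apply_sums(2)[OF c a z this] show ?thesis by (simp add: b_def)
  qed
  note exp = H2_expansion_on_powers_of_2[OF schur(1) this]
  show "g \<in> H2" using exp(1) by (auto simp: H2_def)
  have ng: "(H2_norm g)\<^sup>2 = (\<Sum>k. (cmod (b k))\<^sup>2)"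
    using H2_norm_eq[OF exp(1)] exp(2) schur(1) by (simp add: suminf_nonneg)
  show "(H2_norm g)\<^sup>2 \<le> zeta (2 * Re c1 - r * cmod c2) * (H2_norm f)\<^sup>2"
    using schur(2) H2_norm_eq[OF f] a by (simp add: ng x_def suminf_nonneg)
  have "(cmod (b 0))\<^sup>2 \<le> (H2_norm g)\<^sup>2"
    unfolding ng using sum_le_suminf[OF schur(1), of "{0}"] by simp
  moreover have "0 \<le> H2_norm g" using H2_norm_eq[OF exp(1)] exp(2) schur(1) by (simp add: suminf_nonneg)
  ultimately show "cmod (b 0) \<le> H2_norm g" by (rule power2_le_imp_le)
qed

section \<open>The norm estimate\<close>

text \<open>
  The discriminant is nonnegative because 2 m \<le> d, and the product of the roots is 1, so the smaller
  root lies in (0, 1] and the other one is its inverse.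
\<close>
lemma smallest_root_exists:
  fixes m d :: real
  assumes m: "m > 0" and d: "2 * m \<le> d"
  shows "\<exists>r. smallest_pos_root (\<lambda>r. m * r\<^sup>2 - d * r + m) r \<and> r \<le> 1"
proof (intro exI conjI)
  define w where "w = sqrt (d\<^sup>2 - 4 * m\<^sup>2)"
  define r where "r = (d - w) / (2 * m)"
  have disc: "d\<^sup>2 - 4 * m\<^sup>2 = (d - 2 * m) * (d + 2 * m)" by (simp add: algebra_simps power2_eq_square)
  have w2: "w\<^sup>2 = d\<^sup>2 - 4 * m\<^sup>2" using d m by (simp add: w_def disc)
  have "w < sqrt (d\<^sup>2)" unfolding w_def using m by (intro real_sqrt_less_mono) simp
  then have r0: "r > 0" using m d by (simp add: r_def)
  have "(d - 2 * m)\<^sup>2 \<le> w\<^sup>2" unfolding w2 disc power2_eq_square[of "d - 2 * m"] using m d by (intro mult_left_mono) auto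
  then have "d - 2 * m \<le> w" by (rule power2_le_imp_le) (use d m in \<open>simp add: w_def disc\<close>)
  then show r1: "r \<le> 1" using m by (simp add: r_def)
  have Pr: "m * r\<^sup>2 - d * r + m = 0"
  proof -
    have "4 * m * (m * r\<^sup>2 - d * r + m) = (d - w)\<^sup>2 - 2 * d * (d - w) + 4 * m\<^sup>2"
      using m by (simp add: r_def power_divide field_simps power2_eq_square)
    also have "\<dots> = 0" using w2 by (simp add: power2_eq_square algebra_simps)
    finally show ?thesis using m by simp
  qed
  show "smallest_pos_root (\<lambda>r. m * r\<^sup>2 - d * r + m) r"
    unfolding smallest_pos_root_def
  proof (intro conjI allI impI r0 Pr)
    fix t assume t: "0 < t \<and> m * t\<^sup>2 - d * t + m = 0"
    have "m * ((t * r - 1) * (t - r)) = r * (m * t\<^sup>2 - d * t + m) - t * (m * r\<^sup>2 - d * r + m)"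
      by (simp add: algebra_simps power2_eq_square)
    then have "t * r = 1 \<or> t = r" using t Pr m by simp
    then show "r \<le> t"
    proof
      assume "t * r = 1"
      then have "1 \<le> t" using r0 r1 t by (metis mult_le_cancel_left2 mult.right_neutral less_eq_real_def mult_left_le not_le)
      then show ?thesis using r1 by simp
    qed simp
  qed
qed

theorem theorem3p8:
  fixes c1 c2 :: complex and \<phi> :: "complex \<Rightarrow> complex" and P :: "real \<Rightarrow> real"
  assumes "Re c1 \<ge> 1/2 + cmod c2"
    and "c2 \<noteq> 0"
    and "\<phi> = (\<lambda>s. c1 + c2 * 2 powr (- s))"
    and "P = (\<lambda>r. cmod c2 * r\<^sup>2 + (1 - 2 * Re c1) * r + cmod c2)"
  shows "induces_bounded_comp_op \<phi> \<and>
    (\<exists>r. smallest_pos_root P r \<and> r \<le> 1 \<and>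
       zeta (2 * Re c1) \<le> (H2_onorm (comp_op \<phi>))\<^sup>2 \<and>
       (H2_onorm (comp_op \<phi>))\<^sup>2 \<le> zeta (2 * Re c1 - r * cmod c2))"
proof -
  note c = assms(1,2)
  have P: "P = (\<lambda>r. cmod c2 * r\<^sup>2 - (2 * Re c1 - 1) * r + cmod c2)"
    unfolding assms(4) by (simp add: fun_eq_iff algebra_simps)
  obtain r where r: "smallest_pos_root P r" "r \<le> 1"
    using smallest_root_exists[of "cmod c2" "2 * Re c1 - 1"] c unfolding P by auto
  then have r': "0 < r" "cmod c2 * r\<^sup>2 + (1 - 2 * Re c1) * r + cmod c2 = 0"
    by (auto simp: smallest_pos_root_def assms(4))
  define Z where "Z = zeta (2 * Re c1 - r * cmod c2)"
  note bound = comp_op_H2_bound[OF c r', folded assms(3) Z_def]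
  have norm0: "0 \<le> H2_norm f" if "f \<in> H2" for f
    using that H2_norm_eq by (auto simp: H2_def H2_expansion_def suminf_nonneg)
  have "Re c1 > 1/2" using c(1) zero_less_norm_iff[of c2] c(2) by linarith
  then obtain a0 f0 where f0: "H2_expansion a0 f0" "H2_norm f0 = 1"
    "(\<Sum>n. a0 n * of_nat (Suc n) powr (- c1)) = of_real (sqrt (zeta (2 * Re c1)))"
    by (rule point_evaluation_extremal)
  have f0H: "f0 \<in> H2" using f0(1) by (auto simp: H2_def)
  have "0 \<le> Z" using order_trans[OF zero_le_power2 bound(2)[OF f0(1)]] f0(2) by simp
  have opb: "H2_norm (comp_op \<phi> f) \<le> sqrt Z * H2_norm f" if f: "f \<in> H2" for f
  proof -
    obtain a where a: "H2_expansion a f" using f by (auto simp: H2_def)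
    have "(H2_norm (comp_op \<phi> f))\<^sup>2 \<le> (sqrt Z * H2_norm f)\<^sup>2"
      using bound(2)[OF a] \<open>0 \<le> Z\<close> by (simp add: power_mult_distrib)
    then show ?thesis
      by (rule power2_le_imp_le) (use norm0[OF f] \<open>0 \<le> Z\<close> in simp)
  qed
  have unit: "H2_norm (comp_op \<phi> f) \<le> sqrt Z" if "f \<in> {f \<in> H2. H2_norm f \<le> 1}" for f
    using opb[of f] that mult_left_mono[of "H2_norm f" 1 "sqrt Z"] \<open>0 \<le> Z\<close> by auto
  have bounded: "induces_bounded_comp_op \<phi>"
    unfolding induces_bounded_comp_op_def
  proof (intro conjI)
    show "\<phi> analytic_on half_plane (1/2)"
      unfolding assms(3) powr_def by (auto intro!: analytic_intros)
    show "\<phi> \<in> half_plane (1/2) \<rightarrow> half_plane (1/2)"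
      unfolding assms(3) using symbol_in_half_plane[OF c] cmod_2_powr_less_1 by auto
    show "comp_op \<phi> \<in> H2 \<rightarrow> H2" using bound(1) by (auto simp: H2_def)
    show "\<exists>C. \<forall>f\<in>H2. H2_norm (comp_op \<phi> f) \<le> C * H2_norm f" using opb by blast
  qed
  have upper: "H2_onorm (comp_op \<phi>) \<le> sqrt Z"
    unfolding H2_onorm_def using f0H f0(2) unit by (intro cSUP_least) auto
  have lower: "sqrt (zeta (2 * Re c1)) \<le> H2_onorm (comp_op \<phi>)"
  proof -
    have "sqrt (zeta (2 * Re c1)) \<le> H2_norm (comp_op \<phi> f0)"
      using bound(3)[OF f0(1)] f0(3) by (simp add: comp_matrix_def del: of_nat_Suc)
    also have "\<dots> \<le> H2_onorm (comp_op \<phi>)"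
      unfolding H2_onorm_def using f0H f0(2) unit by (intro cSUP_upper) (auto intro!: bdd_aboveI)
    finally show ?thesis .
  qed
  have z0: "0 \<le> zeta (2 * Re c1)"
    using \<open>Re c1 > 1/2\<close> zeta_pos[of "2 * Re c1"] by simp
  have onorm0: "0 \<le> H2_onorm (comp_op \<phi>)"
    using lower real_sqrt_ge_zero[OF z0] by linarith
  have "zeta (2 * Re c1) \<le> (H2_onorm (comp_op \<phi>))\<^sup>2"
    using power_mono[OF lower, of 2] z0 by simp
  moreover have "(H2_onorm (comp_op \<phi>))\<^sup>2 \<le> Z"
    using power_mono[OF upper onorm0, of 2] \<open>0 \<le> Z\<close> by simp
  ultimately show ?thesis
    using bounded r unfolding Z_def by blast
qed

end
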